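(* Let $X_1,\dots,X_n$ ($n\ge1$) be i.i.d. random variables with variance $\sigma^2$, and let $U\sim\mathrm{Unif}(0,1)$ be an independent random variable. Then, for any $k>0$, $$P\left(|\bar X_n-\mathbb E X|\ge k\sigma\sqrt{\frac{U}{n}}\right)\le \frac1{k^2}.$$ The same result holds when $U$ is stochastically larger than uniform.
   Context: Here $\bar X_n=(X_1+\dots+X_n)/n$, $\mathbb E X$ denotes the common mean of the $X_i$, and $U$ is independent of $(X_1,\dots,X_n)$. A random variable $U$ is stochastically larger than uniform (on $[0,1]$) if $P(U\le u)\le u$ for all $u\in[0,1]$.
   Formalization: The standard deviation σ is assumed strictly positive: if σ = 0 the event is {0 ≥ 0}, of probability 1, so the printed inequality fails for every k > 1 (and is vacuous for k ≤ 1). *)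

theory Defs
  imports "HOL-Probability.Probability"
begin

definition stoch_larger_than_uniform :: "'a measure \<Rightarrow> ('a \<Rightarrow> real) \<Rightarrow> bool" where
  "stoch_larger_than_uniform M U \<longleftrightarrow>
     U \<in> borel_measurable M \<and>
     (\<forall>u\<in>{0..1}. measure M {\<omega> \<in> space M. U \<omega> \<le> u} \<le> u)"

text \<open>The indices of the sample are \<open>1, \<dots>, n\<close>.\<close>

definition sample_mean :: "nat \<Rightarrow> (nat \<Rightarrow> 'a \<Rightarrow> real) \<Rightarrow> 'a \<Rightarrow> real" where
  "sample_mean n X \<omega> = (\<Sum>i=1..n. X i \<omega>) / real n"

definition iid_sample :: "'a measure \<Rightarrow> nat \<Rightarrow> (nat \<Rightarrow> 'a \<Rightarrow> real) \<Rightarrow> bool" where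
  "iid_sample M n X \<longleftrightarrow>
     prob_space.indep_vars M (\<lambda>_. borel) X {1..n} \<and>
     (\<forall>i\<in>{1..n}. \<forall>j\<in>{1..n}. distr M borel (X i) = distr M borel (X j))"

text \<open>Joint independence of \<open>U\<close> from the whole vector \<open>(X 1, \<dots>, X n)\<close>,
  not merely from each component. It is written with the generated sigma-algebras because
  \<^const>\<open>prob_space.indep_var\<close> requires both variables to have the same value type.\<close>

definition indep_of_sample :: "'a measure \<Rightarrow> nat \<Rightarrow> (nat \<Rightarrow> 'a \<Rightarrow> real) \<Rightarrow> ('a \<Rightarrow> real) \<Rightarrow> bool" where
  "indep_of_sample M n X U \<longleftrightarrow>
     U \<in> borel_measurable M \<and>
     (\<lambda>\<omega>. \<lambda>i\<in>{1..n}. X i \<omega>) \<in> M \<rightarrow>\<^sub>M PiM {1..n} (\<lambda>_. borel) \<and>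
     prob_space.indep_set M
       {U -` A \<inter> space M | A. A \<in> sets borel}
       {(\<lambda>\<omega>. \<lambda>i\<in>{1..n}. X i \<omega>) -` B \<inter> space M | B. B \<in> sets (PiM {1..n} (\<lambda>_. borel))}"

end

theory Submission imports Defs begin

text \<open>
  For \<open>U\<close> independent of \<open>Z \<ge> 0\<close>, conditioning on \<open>Z\<close> gives
  \<open>P (U \<le> Z) = E (F Z) \<le> E Z\<close>, where \<open>F z = P (U \<le> z) \<le> z\<close>. The theorem is the case
  \<open>Z = n (mean - E X)\<^sup>2 / (k \<sigma>)\<^sup>2\<close>, whose expectation is \<open>1 / k\<^sup>2\<close> because the variance of
  the sample mean is \<open>\<sigma>\<^sup>2 / n\<close>.
\<close>

text \<open>Induction on \<open>I\<close>: the new summand is independent of the sum of the others,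
  so their product has expectation \<open>0\<close> and only the squares survive. Integrability goes
  through the same induction, since additivity of the integral relies on it.\<close>

lemma (in prob_space) second_moment_sum_centered_indep:
  fixes Y :: "'i \<Rightarrow> 'a \<Rightarrow> real"
  assumes "finite I" "indep_vars (\<lambda>_. borel) Y I"
    and "\<And>i. i \<in> I \<Longrightarrow> integrable M (\<lambda>\<omega>. (Y i \<omega>)\<^sup>2)"
    and "\<And>i. i \<in> I \<Longrightarrow> expectation (Y i) = 0"
  shows "integrable M (\<lambda>\<omega>. (\<Sum>i\<in>I. Y i \<omega>)\<^sup>2)"
    and "expectation (\<lambda>\<omega>. (\<Sum>i\<in>I. Y i \<omega>)\<^sup>2) = (\<Sum>i\<in>I. expectation (\<lambda>\<omega>. (Y i \<omega>)\<^sup>2))"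
proof -
  have "integrable M (\<lambda>\<omega>. (\<Sum>i\<in>I. Y i \<omega>)\<^sup>2) \<and>
    expectation (\<lambda>\<omega>. (\<Sum>i\<in>I. Y i \<omega>)\<^sup>2) = (\<Sum>i\<in>I. expectation (\<lambda>\<omega>. (Y i \<omega>)\<^sup>2))"
    using assms
  proof (induction I rule: finite_induct)
    case empty
    then show ?case by simp
  next
    case (insert i I)
    let ?S = "\<lambda>\<omega>. \<Sum>i\<in>I. Y i \<omega>"
    have rv: "random_variable borel (Y j)" if "j \<in> insert i I" for j
      using insert.prems(1) that unfolding indep_vars_def2 by auto
    have int: "integrable M (Y j)" if "j \<in> insert i I" for j
      using square_integrable_imp_integrable[OF rv] insert.prems(2) that by blast
    have IH: "integrable M (\<lambda>\<omega>. (?S \<omega>)\<^sup>2)"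
      "expectation (\<lambda>\<omega>. (?S \<omega>)\<^sup>2) = (\<Sum>i\<in>I. expectation (\<lambda>\<omega>. (Y i \<omega>)\<^sup>2))"
      using insert.IH indep_vars_subset[OF insert.prems(1), of I] insert.prems(2,3) by auto
    have indep: "indep_var borel (Y i) borel ?S"
      using indep_vars_sum[OF insert.hyps insert.prems(1)] .
    have intS: "integrable M ?S"
      using int by auto
    \<comment> \<open>By independence, integrability of the factors gives that of the product, and
      the expectation factors with \<open>expectation (Y i) = 0\<close>.\<close>
    have cross: "integrable M (\<lambda>\<omega>. Y i \<omega> * ?S \<omega>)" "expectation (\<lambda>\<omega>. Y i \<omega> * ?S \<omega>) = 0"
      using indep_var_integrable[OF indep int intS] indep_var_lebesgue_integral[OF indep int intS]
        insert.prems(3) by auto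
    have sq: "(\<Sum>j\<in>insert i I. Y j \<omega>)\<^sup>2 = (Y i \<omega>)\<^sup>2 + 2 * (Y i \<omega> * ?S \<omega>) + (?S \<omega>)\<^sup>2" for \<omega>
      using insert.hyps by (simp add: power2_sum)
    show ?case
      unfolding sq using insert.hyps insert.prems(2)[of i] IH cross by simp
  qed
  then show "integrable M (\<lambda>\<omega>. (\<Sum>i\<in>I. Y i \<omega>)\<^sup>2)"
    and "expectation (\<lambda>\<omega>. (\<Sum>i\<in>I. Y i \<omega>)\<^sup>2) = (\<Sum>i\<in>I. expectation (\<lambda>\<omega>. (Y i \<omega>)\<^sup>2))"
    by auto
qed

text \<open>Bridges independence stated through preimages, where \<open>X\<close> and
  \<open>V\<close> may have different value types, to \<open>indep_var\<close>, once
  \<open>g\<close> maps into the value type of \<open>X\<close>. Every event of \<open>g\<close>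
  after \<open>V\<close> is already an event of \<open>V\<close>, so passing to \<open>g\<close>
  only shrinks one of the independent families.\<close>

lemma (in prob_space) indep_var_of_indep_vimages:
  assumes X: "random_variable S X" and V: "random_variable N V"
    and g: "g \<in> N \<rightarrow>\<^sub>M T"
    and indep: "indep_set {X -` A \<inter> space M | A. A \<in> sets S} {V -` B \<inter> space M | B. B \<in> sets N}"
  shows "indep_var S X T (\<lambda>\<omega>. g (V \<omega>))"
proof -
  let ?Z = "\<lambda>\<omega>. g (V \<omega>)"
  have Z: "random_variable T ?Z"
    using V g by measurable
  have "?Z -` A \<inter> space M = V -` (g -` A \<inter> space N) \<inter> space M" for A
    using measurable_space[OF V] by auto
  then have sub: "{?Z -` A \<inter> space M | A. A \<in> sets T} \<subseteq> {V -` B \<inter> space M | B. B \<in> sets N}"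
    using measurable_sets[OF g] by (smt (verit) Collect_mono)
  \<comment> \<open>\<open>indep_var_eq\<close> speaks of generated sigma-algebras; preimages of a
    sigma-algebra already form one, so generating adds nothing.\<close>
  have "sigma_sets (space M) {?Z -` A \<inter> space M | A. A \<in> sets T} = {?Z -` A \<inter> space M | A. A \<in> sets T}"
    using sets_vimage_algebra2[of ?Z "space M" T] measurable_space[OF Z]
    by (auto simp only: sets_vimage_algebra Pi_iff)
  moreover have "sigma_sets (space M) {X -` A \<inter> space M | A. A \<in> sets S} = {X -` A \<inter> space M | A. A \<in> sets S}"
    using sets_vimage_algebra2[of X "space M" S] measurable_space[OF X]
    by (auto simp only: sets_vimage_algebra Pi_iff)
  ultimately show ?thesis
    unfolding indep_var_eq using X Z indep sub unfolding indep_sets2_eq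
    by (simp only:) (meson subset_iff subset_trans)
qed

text \<open>Independence makes the joint law a product, so Fubini slices the region
  \<open>fst p \<le> snd p\<close> at each fixed value \<open>z\<close> of \<open>Z\<close>; a slice
  has mass P(U \<le> z), which is at most \<open>z\<close>. Integrating over the law of
  \<open>Z\<close> gives the bound.\<close>

lemma (in prob_space) prob_le_indep_le_expectation:
  fixes U Z :: "'a \<Rightarrow> real"
  assumes U: "stoch_larger_than_uniform M U"
    and indep: "indep_var borel U borel Z"
    and nonneg: "\<And>\<omega>. \<omega> \<in> space M \<Longrightarrow> 0 \<le> Z \<omega>" and int: "integrable M Z"
  shows "prob {\<omega> \<in> space M. U \<omega> \<le> Z \<omega>} \<le> expectation Z"
proof -
  have [measurable]: "random_variable borel U" "random_variable borel Z"
    using indep_var_rv1[OF indep] indep_var_rv2[OF indep] .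
  \<comment> \<open>The assumption on \<open>U\<close> covers \<open>z\<close> in [0,1] only, but
    \<open>Z\<close> is unbounded in general; beyond 1 the bound is trivial.\<close>
  have cdf: "emeasure M {\<omega> \<in> space M. U \<omega> \<le> z} \<le> ennreal z" if "0 \<le> z" for z
  proof (cases "z \<le> 1")
    case True
    then show ?thesis
      using U that by (auto simp: stoch_larger_than_uniform_def emeasure_eq_measure intro!: ennreal_leI)
  next
    case False
    then have "prob {\<omega> \<in> space M. U \<omega> \<le> z} \<le> z"
      using prob_le_1[of "{\<omega> \<in> space M. U \<omega> \<le> z}"] by linarith
    then show ?thesis
      by (simp add: emeasure_eq_measure ennreal_leI)
  qed
  have joint: "distr M borel U \<Otimes>\<^sub>M distr M borel Z = distr M (borel \<Otimes>\<^sub>M borel) (\<lambda>\<omega>. (U \<omega>, Z \<omega>))"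
    using indep unfolding indep_var_distribution_eq by blast
  interpret PU: prob_space "distr M borel U" by (rule prob_space_distr) simp
  interpret PZ: prob_space "distr M borel Z" by (rule prob_space_distr) simp
  interpret UZ: pair_sigma_finite "distr M borel U" "distr M borel Z" ..
  let ?A = "{p :: real \<times> real. fst p \<le> snd p}"
  have A: "?A \<in> sets (borel \<Otimes>\<^sub>M borel)"
    unfolding borel_prod by (intro borel_closed closed_Collect_le continuous_intros)
  have "emeasure M {\<omega> \<in> space M. U \<omega> \<le> Z \<omega>}
      = emeasure (distr M (borel \<Otimes>\<^sub>M borel) (\<lambda>\<omega>. (U \<omega>, Z \<omega>))) ?A"
    using A by (subst emeasure_distr) (auto intro!: arg_cong[where f = "emeasure M"])
  also have "\<dots> = emeasure (distr M borel U \<Otimes>\<^sub>M distr M borel Z) ?A"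
    unfolding joint ..
  also have "\<dots> = (\<integral>\<^sup>+z. emeasure (distr M borel U) ((\<lambda>u. (u, z)) -` ?A) \<partial>distr M borel Z)"
    using A by (intro UZ.emeasure_pair_measure_alt2) simp
  also have "\<dots> = (\<integral>\<^sup>+z. emeasure M {\<omega> \<in> space M. U \<omega> \<le> z} \<partial>distr M borel Z)"
    by (intro nn_integral_cong, subst emeasure_distr)
      (auto intro!: arg_cong[where f = "emeasure M"] simp: vimage_def)
  \<comment> \<open>\<open>cdf\<close> asks for \<open>0 \<le> z\<close>, which holds almost
    everywhere under the law of \<open>Z\<close>, hence the almost-everywhere form of
    monotonicity.\<close>
  also have "\<dots> \<le> (\<integral>\<^sup>+z. ennreal z \<partial>distr M borel Z)"
    using nonneg by (intro nn_integral_mono_AE) (auto simp: AE_distr_iff intro!: cdf)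
  also have "\<dots> = (\<integral>\<^sup>+\<omega>. ennreal (Z \<omega>) \<partial>M)"
    by (subst nn_integral_distr) auto
  also have "\<dots> = ennreal (expectation Z)"
    using nonneg int by (intro nn_integral_eq_integral) auto
  finally show ?thesis
    using nonneg by (simp add: emeasure_eq_measure integral_nonneg_AE)
qed

lemma (in prob_space) uniform_imp_stoch_larger_than_uniform:
  assumes [measurable]: "random_variable borel U"
    and U: "distr M borel U = uniform_measure lborel {0<..<1::real}"
  shows "stoch_larger_than_uniform M U"
  unfolding stoch_larger_than_uniform_def
proof (intro conjI ballI)
  fix u :: real assume u: "u \<in> {0..1}"
  have "prob {\<omega> \<in> space M. U \<omega> \<le> u} = measure (distr M borel U) {..u}"
    by (subst measure_distr) (auto intro!: arg_cong[where f = prob])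
  \<comment> \<open>The normalising constant of the uniform measure is the length of the unit
    interval, namely 1.\<close>
  also have "\<dots> = measure lborel ({0<..<1} \<inter> {..u})"
    unfolding U by (subst measure_uniform_measure) auto
  also have "\<dots> \<le> measure lborel {0..u}"
    using u by (intro measure_mono_fmeasurable) (auto simp: fmeasurable_def)
  finally show "prob {\<omega> \<in> space M. U \<omega> \<le> u} \<le> u"
    using u by simp
qed simp

text \<open>The centered variables \<open>X i - \<mu>\<close> are independent with mean 0, so their
  second moments add up to \<open>n\<close> times the variance; dividing by the square of
  \<open>n\<close> leaves the variance over \<open>n\<close>.\<close>

lemma (in prob_space) second_moment_sample_mean:
  assumes n: "n \<ge> 1" and iid: "iid_sample M n X"
    and sq: "integrable M (\<lambda>\<omega>. (X 1 \<omega>)\<^sup>2)"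
  defines "\<mu> \<equiv> expectation (X 1)"
  shows "integrable M (\<lambda>\<omega>. (sample_mean n X \<omega> - \<mu>)\<^sup>2)"
    and "expectation (\<lambda>\<omega>. (sample_mean n X \<omega> - \<mu>)\<^sup>2) = variance (X 1) / n"
proof -
  have indep: "indep_vars (\<lambda>_. borel) X {1..n}"
    using iid by (simp add: iid_sample_def)
  have rv [measurable]: "random_variable borel (X i)" if "i \<in> {1..n}" for i
    using indep that unfolding indep_vars_def2 by auto
  have rv1: "random_variable borel (X 1)"
    using rv[of 1] n by simp
  have eq: "distr M borel (X i) = distr M borel (X 1)" if "i \<in> {1..n}" for i
    using iid that n unfolding iid_sample_def by (meson atLeastAtMost_iff order_refl)
  \<comment> \<open>Moments depend only on the law, so equality of laws carries what is known of
    \<open>X 1\<close> to every \<open>X i\<close>; \<open>integ\<close> does the same for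
    integrability.\<close>
  have expect: "expectation (\<lambda>\<omega>. f (X i \<omega>)) = expectation (\<lambda>\<omega>. f (X 1 \<omega>))"
    if "i \<in> {1..n}" "f \<in> borel_measurable borel" for i and f :: "real \<Rightarrow> real"
    using integral_distr[OF rv[OF that(1)] that(2)] integral_distr[OF rv1 that(2)] eq[OF that(1)]
    by metis
  have integ: "integrable M (\<lambda>\<omega>. f (X i \<omega>)) \<longleftrightarrow> integrable M (\<lambda>\<omega>. f (X 1 \<omega>))"
    if "i \<in> {1..n}" "f \<in> borel_measurable borel" for i and f :: "real \<Rightarrow> real"
    using integrable_distr_eq[OF rv[OF that(1)] that(2)] integrable_distr_eq[OF rv1 that(2)]
      eq[OF that(1)] by metis
  have int1: "integrable M (X 1)"
    using square_integrable_imp_integrable[OF rv1 sq] .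
  define Y where "Y i \<omega> = X i \<omega> - \<mu>" for i \<omega>
  have "integrable M (\<lambda>\<omega>. (X 1 \<omega> - \<mu>)\<^sup>2)"
    using sq int1 by (simp add: power2_diff)
  then have Ysq: "integrable M (\<lambda>\<omega>. (Y i \<omega>)\<^sup>2)" if "i \<in> {1..n}" for i
    unfolding Y_def using integ[OF that, of "\<lambda>x. (x - \<mu>)\<^sup>2"] by simp
  have Yvar: "expectation (\<lambda>\<omega>. (Y i \<omega>)\<^sup>2) = variance (X 1)" if "i \<in> {1..n}" for i
    unfolding Y_def using expect[OF that, of "\<lambda>x. (x - \<mu>)\<^sup>2"] by (simp add: \<mu>_def)
  have "expectation (\<lambda>\<omega>. X 1 \<omega> - \<mu>) = 0"
    using int1 by (simp add: \<mu>_def prob_space)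
  then have Y0: "expectation (Y i) = 0" if "i \<in> {1..n}" for i
    unfolding Y_def using expect[OF that, of "\<lambda>x. x - \<mu>"] by simp
  have "indep_vars (\<lambda>_. borel) Y {1..n}"
    unfolding Y_def by (rule indep_vars_compose2[OF indep]) simp
  note sum = second_moment_sum_centered_indep[OF _ this Ysq Y0]
  have mean: "(sample_mean n X \<omega> - \<mu>)\<^sup>2 = (\<Sum>i=1..n. Y i \<omega>)\<^sup>2 / (real n)\<^sup>2" for \<omega>
    using n by (simp add: sample_mean_def Y_def sum_subtractf field_simps flip: power_divide)
  show "integrable M (\<lambda>\<omega>. (sample_mean n X \<omega> - \<mu>)\<^sup>2)"
    unfolding mean using sum(1) by simp
  show "expectation (\<lambda>\<omega>. (sample_mean n X \<omega> - \<mu>)\<^sup>2) = variance (X 1) / n"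
    unfolding mean using sum(2) Yvar n by (simp add: power2_eq_square)
qed

text \<open>With \<open>\<sigma> = 0\<close> the threshold would be 0 and the event the whole space,
  which breaks the bound for \<open>k > 1\<close>; hence \<open>\<sigma> > 0\<close>.\<close>

theorem theorem2p1:
  fixes M :: "'a measure" and X :: "nat \<Rightarrow> 'a \<Rightarrow> real" and U :: "'a \<Rightarrow> real"
    and n :: nat and \<sigma> k :: real
  assumes "prob_space M"
    and "n \<ge> 1"
    and "iid_sample M n X"
    and "integrable M (\<lambda>\<omega>. (X 1 \<omega>)\<^sup>2)"
    and "prob_space.variance M (X 1) = \<sigma>\<^sup>2"
    and "\<sigma> > 0"
    and "indep_of_sample M n X U"
    and "k > 0"
  shows "(distr M borel U = uniform_measure lborel {0<..<1} \<longrightarrow>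
            measure M {\<omega> \<in> space M. \<bar>sample_mean n X \<omega> - prob_space.expectation M (X 1)\<bar>
              \<ge> k * \<sigma> * sqrt (U \<omega> / real n)} \<le> 1 / k\<^sup>2) \<and>
         (stoch_larger_than_uniform M U \<longrightarrow>
            measure M {\<omega> \<in> space M. \<bar>sample_mean n X \<omega> - prob_space.expectation M (X 1)\<bar>
              \<ge> k * \<sigma> * sqrt (U \<omega> / real n)} \<le> 1 / k\<^sup>2)"
proof -
  interpret prob_space M by fact
  define \<mu> where "\<mu> = expectation (X 1)"
  \<comment> \<open>Obtained by squaring the deviation inequality and solving it for
    \<open>U\<close>.\<close>
  define Z where "Z \<omega> = real n * (sample_mean n X \<omega> - \<mu>)\<^sup>2 / (k * \<sigma>)\<^sup>2" for \<omega>
  let ?V = "\<lambda>\<omega>. \<lambda>i\<in>{1..n}. X i \<omega>"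
  let ?g = "\<lambda>x. real n * ((\<Sum>i=1..n. x i) / real n - \<mu>)\<^sup>2 / (k * \<sigma>)\<^sup>2"
  let ?E = "{\<omega> \<in> space M. k * \<sigma> * sqrt (U \<omega> / real n) \<le> \<bar>sample_mean n X \<omega> - \<mu>\<bar>}"
  have U [measurable]: "random_variable borel U" and V: "random_variable (PiM {1..n} (\<lambda>_. borel)) ?V"
    using \<open>indep_of_sample M n X U\<close> by (auto simp: indep_of_sample_def)
  \<comment> \<open>\<open>Z\<close> is \<open>?g\<close> of the sample vector, so independence of
    \<open>U\<close> from the whole vector passes to \<open>Z\<close>.\<close>
  have "?g \<in> borel_measurable (PiM {1..n} (\<lambda>_. borel))"
    by measurable
  then have "indep_var borel U borel (\<lambda>\<omega>. ?g (?V \<omega>))"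
    using indep_var_of_indep_vimages[OF U V] \<open>indep_of_sample M n X U\<close>
    unfolding indep_of_sample_def by blast
  then have indep: "indep_var borel U borel Z"
    by (simp add: Z_def[abs_def] sample_mean_def)
  note mean = second_moment_sample_mean[OF \<open>n \<ge> 1\<close> \<open>iid_sample M n X\<close>
      \<open>integrable M (\<lambda>\<omega>. (X 1 \<omega>)\<^sup>2)\<close>, folded \<mu>_def]
  have int: "integrable M Z"
    unfolding Z_def using mean(1) by simp
  have EZ: "expectation Z = 1 / k\<^sup>2"
    unfolding Z_def using mean(2) assms(5) \<open>n \<ge> 1\<close> \<open>\<sigma> > 0\<close> \<open>k > 0\<close>
    by (simp add: \<mu>_def power_mult_distrib)
  \<comment> \<open>Isabelle's \<open>sqrt\<close> is negative on negative arguments, but \<open>U < 0\<close> also implies \<open>U \<le> Z\<close>.\<close>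
  have le: "U \<omega> \<le> Z \<omega>" if "k * \<sigma> * sqrt (U \<omega> / real n) \<le> \<bar>sample_mean n X \<omega> - \<mu>\<bar>" for \<omega>
  proof (cases "U \<omega> < 0")
    case True
    moreover have "0 \<le> Z \<omega>" by (simp add: Z_def)
    ultimately show ?thesis by linarith
  next
    case False
    have "(k * \<sigma> * sqrt (U \<omega> / real n))\<^sup>2 \<le> \<bar>sample_mean n X \<omega> - \<mu>\<bar>\<^sup>2"
      using that False \<open>\<sigma> > 0\<close> \<open>k > 0\<close> by (intro power_mono) auto
    then have "(k * \<sigma>)\<^sup>2 * (U \<omega> / real n) \<le> (sample_mean n X \<omega> - \<mu>)\<^sup>2"
      using False by (simp add: power_mult_distrib)
    then show ?thesis
      using \<open>n \<ge> 1\<close> \<open>\<sigma> > 0\<close> \<open>k > 0\<close> by (simp add: Z_def field_simps)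
  qed
  have main: "prob ?E \<le> 1 / k\<^sup>2" if "stoch_larger_than_uniform M U"
  proof -
    have [measurable]: "random_variable borel Z"
      using int by simp
    \<comment> \<open>Monotonicity calls for measurability of the larger event, supplied by that of
      \<open>U\<close> and \<open>Z\<close>.\<close>
    have "prob ?E \<le> prob {\<omega> \<in> space M. U \<omega> \<le> Z \<omega>}"
      using le by (intro finite_measure_mono) auto
    also have "\<dots> \<le> expectation Z"
      using prob_le_indep_le_expectation[OF that indep _ int] by (simp add: Z_def)
    finally show ?thesis
      using EZ by simp
  qed
  \<comment> \<open>The uniform case reduces to the stochastically larger one.\<close>
  then show ?thesis
    using uniform_imp_stoch_larger_than_uniform[OF U] by (simp add: \<mu>_def)
qed

end
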